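(* Let $0\le\beta<1$ and let $p\in\mathbf{N}_0$ be fixed. Then there exists a positive constant $M_3(b_1,p,\beta)$, depending only on $b_1,p,\beta$, such that for every $f\in C_p^2$, all $x\in\mathbf{R}_0$ and all $n\in\mathbf{N}$, $$\omega_p(x)\left|J_n^{[\beta]}(f;a_n,b_n;x)-f(x)\right|\le \|f'\|_p\left|\frac{a_n}{b_n(1-\beta)}-1\right|x+\|f''\|_p\,M_3(b_1,p,\beta)\,\xi_{n,\beta}(x).$$
   Context: $\mathbf{R}_0=[0,\infty)$, $\mathbf{N}=\{1,2,\dots\}$, $\mathbf{N}_0=\mathbf{N}\cup\{0\}$. Throughout, $(a_n)_{n\ge1}$ and $(b_n)_{n\ge1}$ are given increasing unbounded real sequences with $a_n\ge1$, $b_n\ge1$, such that $(a_n/b_n)_{n\ge1}$ is non-decreasing and $a_n/b_n=1+o(1/b_n)$ as $n\to\infty$. For $0\le\beta<1$, $\alpha\in\mathbf{R}_0$, $k\in\mathbf{N}_0$ put $$\omega_\beta(k,\alpha)=\frac{\alpha}{k!}(\alpha+k\beta)^{k-1}e^{-(\alpha+k\beta)},$$ with $\omega_\beta(0,\alpha)=e^{-\alpha}$ (in particular $\omega_\beta(0,0)=1$) and $\omega_\beta(k,0)=0$ for $k\ge1$. The operators are $$J_n^{[\beta]}(f;a_n,b_n;x)=\sum_{k=0}^\infty \omega_\beta(k,a_nx)\,f\!\left(\frac{k}{b_n}\right),\qquad x\in\mathbf{R}_0,\ n\in\mathbf{N}.$$ Weights: $\omega_0(x)=1$ and $\omega_p(x)=(1+x^p)^{-1}$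 for $p\ge1$, $x\in\mathbf{R}_0$. $B_p$ is the set of all $f:\mathbf{R}_0\to\mathbf{R}$ with $f\omega_p$ bounded on $\mathbf{R}_0$, normed by $\|f\|_p=\sup_{x\in\mathbf{R}_0}\omega_p(x)|f(x)|$. $C_p$ is the set of all $f\in B_p$ for which $f\omega_p$ is uniformly continuous on $\mathbf{R}_0$. $C_p^2$ is the set of twice differentiable $f\in C_p$ with $f',f''\in C_p$. Finally, $$\xi_{n,\beta}(x)=x^2\left(\frac{a_n}{b_n(1-\beta)}-1\right)^2+\frac{x}{b_n(1-\beta)^3},\qquad x\in\mathbf{R}_0,\ n\in\mathbf{N}.$$ *)

theory Defs
  imports "HOL-Analysis.Analysis" "HOL-Library.Landau_Symbols"
begin

text \<open>
  Functions on \<open>[0,\<infinity>)\<close> are represented by total functions \<open>real \<Rightarrow> real\<close>; every definition below only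
  inspects their values on \<open>{0..}\<close>. Sequences are indexed by \<open>n \<ge> 1\<close>; the value at \<open>0\<close> is irrelevant.
\<close>

definition admissible :: "(nat \<Rightarrow> real) \<Rightarrow> (nat \<Rightarrow> real) \<Rightarrow> bool" where
  "admissible a b \<longleftrightarrow>
     (\<forall>n\<ge>1. a n \<ge> 1) \<and> (\<forall>n\<ge>1. b n \<ge> 1) \<and>
     strict_mono_on {1..} a \<and> strict_mono_on {1..} b \<and>
     \<not> bounded (a ` {1..}) \<and> \<not> bounded (b ` {1..}) \<and>
     mono_on {1..} (\<lambda>n. a n / b n) \<and>
     (\<lambda>n. a n / b n - 1) \<in> o(\<lambda>n. 1 / b n)"

text \<open>
  For \<open>k = 0\<close> the general formula \<open>\<alpha> / k! * (\<alpha> + k \<beta>) ^ (k - 1) * exp (- (\<alpha> + k \<beta>))\<close> has exponent \<open>-1\<close>,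
  hence the separate case (which also covers \<open>\<alpha> = 0\<close>). For \<open>k \<ge> 1\<close> and \<open>\<alpha> = 0\<close> the formula gives \<open>0\<close>.
\<close>

definition gen_poisson :: "real \<Rightarrow> nat \<Rightarrow> real \<Rightarrow> real" where
  "gen_poisson \<beta> k \<alpha> =
     (if k = 0 then exp (- \<alpha>)
      else \<alpha> / fact k * (\<alpha> + real k * \<beta>) ^ (k - 1) * exp (- (\<alpha> + real k * \<beta>)))"

definition J_op ::
  "real \<Rightarrow> (nat \<Rightarrow> real) \<Rightarrow> (nat \<Rightarrow> real) \<Rightarrow> nat \<Rightarrow> (real \<Rightarrow> real) \<Rightarrow> real \<Rightarrow> real" where
  "J_op \<beta> a b n f x = (\<Sum>k. gen_poisson \<beta> k (a n * x) * f (real k / b n))"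

definition weight :: "nat \<Rightarrow> real \<Rightarrow> real" where
  "weight p x = (if p = 0 then 1 else 1 / (1 + x ^ p))"

definition B_space :: "nat \<Rightarrow> (real \<Rightarrow> real) set" where
  "B_space p = {f. bounded ((\<lambda>x. f x * weight p x) ` {0..})}"

definition wnorm :: "nat \<Rightarrow> (real \<Rightarrow> real) \<Rightarrow> real" where
  "wnorm p f = (SUP x\<in>{0..}. weight p x * \<bar>f x\<bar>)"

definition C_space :: "nat \<Rightarrow> (real \<Rightarrow> real) set" where
  "C_space p = {f \<in> B_space p. uniformly_continuous_on {0..} (\<lambda>x. f x * weight p x)}"

text \<open>The derivative of a function on \<open>[0,\<infinity>)\<close>: one-sided at \<open>0\<close>, two-sided elsewhere.\<close>

definition deriv0 :: "(real \<Rightarrow> real) \<Rightarrow> real \<Rightarrow> real" where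
  "deriv0 f x = vector_derivative f (at x within {0..})"

definition C2_space :: "nat \<Rightarrow> (real \<Rightarrow> real) set" where
  "C2_space p = {f \<in> C_space p.
     f differentiable_on {0..} \<and> deriv0 f differentiable_on {0..} \<and>
     deriv0 f \<in> C_space p \<and> deriv0 (deriv0 f) \<in> C_space p}"

definition xi :: "real \<Rightarrow> (nat \<Rightarrow> real) \<Rightarrow> (nat \<Rightarrow> real) \<Rightarrow> nat \<Rightarrow> real \<Rightarrow> real" where
  "xi \<beta> a b n x =
     x\<^sup>2 * (a n / (b n * (1 - \<beta>)) - 1)\<^sup>2 + x / (b n * (1 - \<beta>) ^ 3)"

end

theory Submission
  imports Defs
begin

text \<open>
  Write \<open>Y\<close> for a random variable with the generalized Poisson law \<open>gen_poisson \<beta> \<cdot> \<alpha>\<close>,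
  where \<open>\<alpha> = a n * x\<close>. Then \<open>J_op \<beta> a b n f x\<close> is the expectation of \<open>f (Y / b n)\<close>, and a first order
  Taylor expansion at \<open>x\<close> leaves \<open>f' x\<close> times the bias \<open>E (Y / b n) - x\<close> and a remainder of size at most
  \<open>\<parallel>f''\<parallel>\<^sub>p (1 / weight p x + 1 / weight p t) (t - x)\<^sup>2\<close> at \<open>t = Y / b n\<close>. The theorem thus rests on three
  facts: the law has total mass \<open>1\<close>; its mean is \<open>\<alpha> / (1 - \<beta>)\<close>, which produces the
  first term of the estimate with constant exactly \<open>1\<close>; and, with \<open>\<mu> = \<alpha> / (1 - \<beta>)\<close>, the weighted central
  moment \<open>E ((Y - \<mu>)\<^sup>2 * Y ^ p)\<close> is at most \<open>C * \<alpha> * (1 + \<alpha>) ^ p\<close>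
  (\<open>central_moment_bound\<close>). This is one power below the order \<open>(1 + \<alpha>) ^ (p + 2)\<close> of the separate terms
  of the expanded square, and it vanishes at \<open>\<alpha> = 0\<close>; after division by \<open>b n ^ (p + 2)\<close> both are needed to arrive at \<open>x / b n\<close> times \<open>(1 + x) ^ p\<close>.

  Mass and mean come from generating functions. The probabilities are, up to exponential factors, the
  Abel polynomials \<open>P\<^sub>n(x) = x (x + n \<beta>)\<^bsup>n - 1\<^esup> / n!\<close>. Abel's convolution identity
  says that \<open>G(u) = \<Sum>\<^sub>n P\<^sub>n(\<alpha>) u\<^sup>n\<close> solves \<open>G' = \<alpha> T' G\<close>, so \<open>G = exp (\<alpha> T)\<close> for a
  function \<open>T\<close> independent of \<open>\<alpha>\<close>, and the case \<open>\<alpha> = \<beta>\<close> gives \<open>T = u exp (\<beta> T)\<close>. At \<open>u = exp (- \<beta>)\<close> the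
  solution on the right branch is \<open>T = 1\<close>, because \<open>\<beta> < 1\<close>. Its value and its derivative there give the
  mass and the mean.

  The same convolution identity, read at \<open>u = exp (- \<beta>)\<close>, says that the law is compound Poisson:
  \<open>E (Y h(Y)) = \<alpha> \<Sum>\<^sub>i c\<^sub>i E (h (Y + i + 1))\<close> with weights \<open>c\<^sub>i \<ge> 0\<close> that do not depend on \<open>\<alpha>\<close>.
  For powers \<open>h\<close> this is a recursion for the moments (\<open>moment_recursion\<close>) with nonnegative
  coefficients. It bounds the \<open>j\<close>-th moment by \<open>C (1 + \<alpha>) ^ j\<close> and makes
  the leading terms of the central moment cancel exactly, with a remaining negative term that
  can be dropped.
\<close>

section \<open>Abel polynomials and their convolution identity\<close>

definition abel_poly :: "real \<Rightarrow> nat \<Rightarrow> real \<Rightarrow> real" where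
  "abel_poly \<beta> n x = (if n = 0 then 1 else x * (x + real n * \<beta>) ^ (n - 1) / fact n)"

definition abel_power :: "real \<Rightarrow> nat \<Rightarrow> real \<Rightarrow> real" where
  "abel_power \<beta> n x = (x + real n * \<beta>) ^ n / fact n"

lemma gen_poisson_abel_poly:
  "gen_poisson \<beta> k \<alpha> = abel_poly \<beta> k \<alpha> * exp (- \<beta>) ^ k * exp (- \<alpha>)"
  by (simp add: gen_poisson_def abel_poly_def exp_of_nat_mult [symmetric] mult.commute
      flip: exp_add)

lemma abel_poly_0 [simp]: "abel_poly \<beta> 0 x = 1"
  by (simp add: abel_poly_def)

lemma abel_power_0 [simp]: "abel_power \<beta> 0 x = 1"
  by (simp add: abel_power_def)

lemma abel_poly_at_0: "abel_poly \<beta> n 0 = (if n = 0 then 1 else 0)"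
  by (simp add: abel_poly_def)

lemma Suc_mult_div_fact: "real (Suc n) * x / fact (Suc n) = x / fact n"
  by (simp del: of_nat_Suc)

lemma has_derivative_abel_poly:
  "(abel_poly \<beta> (Suc n) has_real_derivative abel_poly \<beta> n (x + \<beta>)) (at x)"
proof (cases n)
  case 0
  then show ?thesis
    unfolding abel_poly_def by (auto intro!: derivative_eq_intros)
next
  case (Suc m)
  have 1: "abel_poly \<beta> (Suc n) = (\<lambda>x. x * (x + real (Suc n) * \<beta>) ^ n / fact (Suc n))"
    by (rule ext) (simp add: abel_poly_def)
  have 2: "((\<lambda>x. x * (x + real (Suc n) * \<beta>) ^ n / fact (Suc n)) has_real_derivative
      ((x + real (Suc n) * \<beta>) ^ n + x * (real n * (x + real (Suc n) * \<beta>) ^ m)) / fact (Suc n))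
      (at x)"
    by (rule derivative_eq_intros refl | simp add: Suc)+
  have 3: "(x + real (Suc n) * \<beta>) ^ n + x * (real n * (x + real (Suc n) * \<beta>) ^ m)
      = real (Suc n) * ((x + \<beta>) * (x + real (Suc n) * \<beta>) ^ m)"
    using Suc by (simp add: algebra_simps)
  have 4: "abel_poly \<beta> n (x + \<beta>) = (x + \<beta>) * (x + real (Suc n) * \<beta>) ^ m / fact n"
    using Suc by (simp add: abel_poly_def algebra_simps)
  show ?thesis
    unfolding 1 4 using 2 unfolding 3 by (simp only: Suc_mult_div_fact)
qed

lemma has_derivative_abel_power:
  "(abel_power \<beta> (Suc n) has_real_derivative abel_power \<beta> n (x + \<beta>)) (at x)"
proof -
  have 1: "abel_power \<beta> (Suc n) = (\<lambda>x. (x + real (Suc n) * \<beta>) ^ Suc n / fact (Suc n))"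
    by (rule ext) (simp add: abel_power_def)
  have 2: "((\<lambda>x. (x + real (Suc n) * \<beta>) ^ Suc n / fact (Suc n)) has_real_derivative
      (real (Suc n) * (x + real (Suc n) * \<beta>) ^ n) / fact (Suc n)) (at x)"
    by (rule derivative_eq_intros refl | simp)+
  have 4: "abel_power \<beta> n (x + \<beta>) = (x + real (Suc n) * \<beta>) ^ n / fact n"
    by (simp add: abel_power_def algebra_simps)
  show ?thesis
    unfolding 1 4 using 2 by (simp add: field_simps del: of_nat_Suc)
qed

lemma has_derivative_abel_power_shift:
  "((\<lambda>x. abel_power \<beta> (Suc n) (y + x)) has_real_derivative abel_power \<beta> n (y + x + \<beta>)) (at x)"
  using has_derivative_abel_power [of \<beta> n "x + y"]
  by (simp add: DERIV_shift add.commute)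

text \<open>
  Abel's generalization of the binomial theorem. Differentiation in \<open>x\<close> acts on both families as a lowering of
  the index together with the shift \<open>x \<mapsto> x + \<beta>\<close>, so the derivative of the identity for \<open>n + 1\<close> is the identity
  for \<open>n\<close> at \<open>x + \<beta>\<close>; at \<open>x = 0\<close> only the term \<open>i = n\<close> survives.
\<close>
lemma abel_convolution:
  "(\<Sum>i\<le>n. abel_power \<beta> i y * abel_poly \<beta> (n - i) x) = abel_power \<beta> n (y + x)"
proof (induction n arbitrary: x)
  case 0
  then show ?case by simp
next
  case (Suc n)
  define g where
    "g = (\<lambda>x. (\<Sum>i\<le>Suc n. abel_power \<beta> i y * abel_poly \<beta> (Suc n - i) x)
               - abel_power \<beta> (Suc n) (y + x))"
  have split: "(\<Sum>i\<le>Suc n. abel_power \<beta> i y * abel_poly \<beta> (Suc n - i) x)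
      = (\<Sum>i\<le>n. abel_power \<beta> i y * abel_poly \<beta> (Suc (n - i)) x) + abel_power \<beta> (Suc n) y" for x
    by (simp add: Suc_diff_le)
  have "(g has_real_derivative 0) (at x)" for x
  proof -
    have "(g has_real_derivative
        (\<Sum>i\<le>n. abel_power \<beta> i y * abel_poly \<beta> (n - i) (x + \<beta>)) + 0
        - abel_power \<beta> n (y + x + \<beta>)) (at x)"
      unfolding g_def split
      by (intro DERIV_diff DERIV_add DERIV_sum DERIV_cmult has_derivative_abel_poly DERIV_const
          has_derivative_abel_power_shift)
    then show ?thesis
      by (simp add: Suc.IH add.assoc)
  qed
  then have "g x = g 0"
    by (intro DERIV_isconst_all) auto
  also have "g 0 = 0"
    unfolding g_def split by (simp add: abel_poly_at_0)
  finally show ?case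
    by (simp add: g_def)
qed

lemma Suc_mult_abel_poly:
  "real (Suc n) * abel_poly \<beta> (Suc n) x = x * abel_power \<beta> n (\<beta> + x)"
proof -
  have "abel_poly \<beta> (Suc n) x = x * (\<beta> + x + real n * \<beta>) ^ n / fact (Suc n)"
    by (simp add: abel_poly_def algebra_simps)
  then show ?thesis
    by (simp add: abel_power_def del: of_nat_Suc)
qed

text \<open>
  In terms of generating functions: for \<open>T(u) = \<Sum>\<^sub>n abel_poly \<beta> n \<beta> * u ^ (n + 1)\<close> the coefficients of
  \<open>T'\<close> are the numbers \<open>abel_power \<beta> n \<beta>\<close>.
\<close>
lemma Suc_mult_abel_poly_self:
  "real (Suc n) * abel_poly \<beta> n \<beta> = abel_power \<beta> n \<beta>"
proof (cases n)
  case (Suc m)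
  have "\<beta> + real n * \<beta> = real (Suc n) * \<beta>"
    by (simp add: algebra_simps)
  then show ?thesis
    using Suc by (simp add: abel_poly_def abel_power_def)
qed simp

text \<open>
  In terms of the generating function in the index, this is the differential equation \<open>G' = \<alpha> T' G\<close>; in terms of the
  generalized Poisson law it is the compound Poisson recursion.
\<close>
corollary abel_poly_recursion:
  "real (Suc n) * abel_poly \<beta> (Suc n) x
     = x * (\<Sum>i\<le>n. abel_power \<beta> i \<beta> * abel_poly \<beta> (n - i) x)"
  by (simp only: abel_convolution Suc_mult_abel_poly)

lemma power_div_fact_le_exp:
  fixes y :: real
  assumes "y \<ge> 0"
  shows "y ^ n / fact n \<le> exp y"
proof -
  have "(\<Sum>k\<in>{n}. y ^ k /\<^sub>R fact k) \<le> (\<Sum>k. y ^ k /\<^sub>R fact k)"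
    by (rule sum_le_suminf) (use assms summable_exp_generic[of y] in auto)
  then show ?thesis
    by (simp add: exp_def field_simps)
qed

text \<open>
  The parameter \<open>s\<close> is free: \<open>exp (s * \<beta>) / s\<close> is smallest at \<open>s = 1 / \<beta>\<close>, and any \<open>s\<close> between \<open>1\<close> and
  \<open>1 / \<beta>\<close> gives a geometric bound strong enough to reach beyond \<open>u = exp (- \<beta>)\<close>. Keeping \<open>s\<close> variable treats
  \<open>\<beta> = 0\<close> alongside \<open>\<beta> > 0\<close>.
\<close>
lemma abel_power_le:
  assumes "0 \<le> \<beta>" "0 \<le> x" "0 < s"
  shows "abel_power \<beta> n x \<le> exp (s * x) * (exp (s * \<beta>) / s) ^ n"
proof -
  have "(s * (x + real n * \<beta>)) ^ n / fact n \<le> exp (s * (x + real n * \<beta>))"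
    using assms by (intro power_div_fact_le_exp) auto
  also have "\<dots> = exp (s * x) * exp (s * \<beta>) ^ n"
    by (simp add: exp_of_nat_mult [symmetric] algebra_simps flip: exp_add)
  finally have "s ^ n * abel_power \<beta> n x \<le> exp (s * x) * exp (s * \<beta>) ^ n"
    by (simp add: abel_power_def power_mult_distrib)
  then show ?thesis
    using assms by (simp add: field_simps power_divide)
qed

lemma abel_poly_le_power:
  assumes "0 \<le> \<beta>" "0 \<le> x"
  shows "abel_poly \<beta> n x \<le> abel_power \<beta> n x"
proof (cases n)
  case (Suc m)
  have "x * (x + real n * \<beta>) ^ m \<le> (x + real n * \<beta>) * (x + real n * \<beta>) ^ m"
    using assms by (intro mult_right_mono) auto
  then show ?thesis
    using Suc by (simp add: abel_poly_def abel_power_def divide_right_mono)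
qed simp

lemma abel_poly_nonneg: "0 \<le> \<beta> \<Longrightarrow> 0 \<le> x \<Longrightarrow> 0 \<le> abel_poly \<beta> n x"
  by (simp add: abel_poly_def)

lemma abel_power_nonneg: "0 \<le> \<beta> \<Longrightarrow> 0 \<le> x \<Longrightarrow> 0 \<le> abel_power \<beta> n x"
  by (simp add: abel_power_def)

text \<open>Each factor \<open>n\<close> is one termwise differentiation, up to a factor \<open>u\<close>.\<close>
lemma summable_power_times_powser:
  fixes c :: "nat \<Rightarrow> real"
  assumes conv: "\<And>u. \<bar>u\<bar> < r \<Longrightarrow> summable (\<lambda>n. c n * u ^ n)"
  shows "\<bar>u\<bar> < r \<Longrightarrow> summable (\<lambda>n. real n ^ j * c n * u ^ n)"
proof (induction j arbitrary: u)
  case 0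
  then show ?case using conv by simp
next
  case (Suc j)
  have "summable (\<lambda>n. diffs (\<lambda>n. real n ^ j * c n) n * u ^ n)"
    using Suc by (intro termdiff_converges[where K = r]) auto
  then have "summable (\<lambda>n. diffs (\<lambda>n. real n ^ j * c n) n * u ^ n * u)"
    by (rule summable_mult2)
  also have "(\<lambda>n. diffs (\<lambda>n. real n ^ j * c n) n * u ^ n * u)
      = (\<lambda>n. real (Suc n) ^ Suc j * c (Suc n) * u ^ Suc n)"
    by (auto simp: diffs_def algebra_simps)
  finally show ?case
    by (subst (asm) summable_Suc_iff)
qed

section \<open>The generating function of the Abel polynomials\<close>

text \<open>
  The inverse of the solution \<open>T\<close> of \<open>T = u * exp (\<beta> * T)\<close>. For \<open>\<beta> = 1\<close> the function \<open>T\<close> is the tree function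
  of enumerative combinatorics.
\<close>
definition inv_tree_fn :: "real \<Rightarrow> real \<Rightarrow> real" where
  "inv_tree_fn \<beta> z = z * exp (- (\<beta> * z))"

text \<open>
  Any number \<open>s > 1\<close> with \<open>\<beta> * s < 1\<close> would serve: \<open>inv_tree_fn \<beta>\<close> increases on \<open>[0, s]\<close>, and all power series
  below converge for \<open>\<bar>u\<bar> < inv_tree_fn \<beta> s\<close>, a range that contains \<open>exp (- \<beta>) = inv_tree_fn \<beta> 1\<close>.
\<close>
definition cutoff :: "real \<Rightarrow> real" where
  "cutoff \<beta> = 2 / (1 + \<beta>)"

lemma inv_tree_fn_strict_mono:
  assumes "0 \<le> \<beta>" "0 \<le> z" "z < w" "\<beta> * w < 1"
  shows "inv_tree_fn \<beta> z < inv_tree_fn \<beta> w"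
proof (rule DERIV_pos_imp_increasing[where f = "inv_tree_fn \<beta>"])
  fix y assume y: "z \<le> y" "y \<le> w"
  have "\<beta> * y \<le> \<beta> * w" using y assms by (intro mult_left_mono) auto
  then have "\<beta> * y < 1" using assms by simp
  moreover have "(inv_tree_fn \<beta> has_real_derivative (1 - \<beta> * y) * exp (- (\<beta> * y))) (at y)"
    unfolding inv_tree_fn_def by (auto intro!: derivative_eq_intros simp: algebra_simps)
  ultimately show "\<exists>d. (inv_tree_fn \<beta> has_real_derivative d) (at y) \<and> d > 0"
    by (intro exI conjI) auto
qed (use assms in auto)

context
  fixes \<beta> :: real
  assumes beta: "0 \<le> \<beta>" "\<beta> < 1"
begin

private abbreviation "s \<equiv> cutoff \<beta>"
private abbreviation "R \<equiv> inv_tree_fn \<beta> s"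
private abbreviation "u\<^sub>0 \<equiv> exp (- \<beta>)"

lemma cutoff: "1 < s" "\<beta> * s < 1"
  using beta by (auto simp: cutoff_def field_simps)

lemma radius: "u\<^sub>0 < R"
  using inv_tree_fn_strict_mono[of \<beta> 1 s] beta cutoff by (simp add: inv_tree_fn_def)

lemma radius_pos: "0 < R"
  using radius by (meson exp_gt_zero order.strict_trans)

lemma summable_abel_bound:
  assumes c: "\<And>n. \<bar>c n\<bar> \<le> K * (exp (s * \<beta>) / s) ^ n" and u: "\<bar>u\<bar> < R"
  shows "summable (\<lambda>n. c n * u ^ n)"
proof (rule summable_comparison_test', rule summable_mult)
  have "inverse R = exp (s * \<beta>) / s"
    using cutoff by (simp add: inv_tree_fn_def exp_minus field_simps)
  then have eq: "exp (s * \<beta>) / s * \<bar>u\<bar> = \<bar>u\<bar> / R"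
    by (metis divide_inverse mult.commute)
  show "summable (\<lambda>n. (\<bar>u\<bar> / R) ^ n)"
    using u radius_pos by (intro summable_geometric) simp
  show "norm (c n * u ^ n) \<le> K * (\<bar>u\<bar> / R) ^ n" for n
    using mult_right_mono[OF c[of n], of "\<bar>u\<bar> ^ n"]
    by (simp add: abs_mult power_abs power_mult_distrib [of "exp (s * \<beta>) / s"] mult.assoc
        flip: eq del: times_divide_eq_left)
qed

lemma summable_abel_power:
  assumes "0 \<le> x" "\<bar>u\<bar> < R"
  shows "summable (\<lambda>n. abel_power \<beta> n x * u ^ n)"
  using assms abel_power_le[of \<beta> x s] beta cutoff
  by (intro summable_abel_bound[where K = "exp (s * x)"]) (auto simp: abel_power_nonneg)

lemma summable_abel_poly:
  assumes "0 \<le> x" "\<bar>u\<bar> < R"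
  shows "summable (\<lambda>n. abel_poly \<beta> n x * u ^ n)"
proof (rule summable_abel_bound[where K = "exp (s * x)"])
  fix n
  show "\<bar>abel_poly \<beta> n x\<bar> \<le> exp (s * x) * (exp (s * \<beta>) / s) ^ n"
    using abel_poly_le_power[of \<beta> x n] abel_power_le[of \<beta> x s n] assms beta cutoff
    by (simp add: abel_poly_nonneg)
qed fact

definition abel_gf :: "real \<Rightarrow> real \<Rightarrow> real" where
  "abel_gf \<alpha> u = (\<Sum>n. abel_poly \<beta> n \<alpha> * u ^ n)"

text \<open>
  The definition anticipates \<open>abel_gf \<beta> u = exp (\<beta> * tree_fn u)\<close>, so that the functional
  equation holds as soon as \<open>abel_gf\<close> is known to be an exponential in its first argument.
\<close>
definition tree_fn :: "real \<Rightarrow> real" where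
  "tree_fn u = u * abel_gf \<beta> u"

lemma tree_fn_powser:
  assumes u: "\<bar>u\<bar> < R"
  shows "tree_fn u = (\<Sum>n. (case n of 0 \<Rightarrow> 0 | Suc m \<Rightarrow> abel_poly \<beta> m \<beta>) * u ^ n)"
    and "summable (\<lambda>n. (case n of 0 \<Rightarrow> 0 | Suc m \<Rightarrow> abel_poly \<beta> m \<beta>) * u ^ n)"
proof -
  have "(\<lambda>n. u * (abel_poly \<beta> n \<beta> * u ^ n)) sums tree_fn u"
    unfolding tree_fn_def abel_gf_def using summable_abel_poly[OF beta(1) u]
    by (intro sums_mult summable_sums)
  then have "(\<lambda>n. (case n of 0 \<Rightarrow> 0 | Suc m \<Rightarrow> abel_poly \<beta> m \<beta>) * u ^ n) sums tree_fn u"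
    using sums_Suc_iff[of "\<lambda>n. (case n of 0 \<Rightarrow> 0 | Suc m \<Rightarrow> abel_poly \<beta> m \<beta>) * u ^ n" "tree_fn u"]
    by (simp add: mult_ac)
  then show "tree_fn u = (\<Sum>n. (case n of 0 \<Rightarrow> 0 | Suc m \<Rightarrow> abel_poly \<beta> m \<beta>) * u ^ n)"
    and "summable (\<lambda>n. (case n of 0 \<Rightarrow> 0 | Suc m \<Rightarrow> abel_poly \<beta> m \<beta>) * u ^ n)"
    by (auto simp: sums_iff)
qed

lemma has_derivative_tree_fn:
  assumes u: "\<bar>u\<bar> < R"
  shows "(tree_fn has_real_derivative (\<Sum>n. abel_power \<beta> n \<beta> * u ^ n)) (at u)"
proof -
  let ?c = "\<lambda>n. case n of 0 \<Rightarrow> 0 | Suc m \<Rightarrow> abel_poly \<beta> m \<beta>"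
  have "((\<lambda>u. \<Sum>n. ?c n * u ^ n) has_real_derivative (\<Sum>n. diffs ?c n * u ^ n)) (at u)"
    using u tree_fn_powser(2) by (intro termdiffs_strong'[where K = R]) auto
  moreover have "diffs ?c = (\<lambda>n. abel_power \<beta> n \<beta>)"
    by (rule ext) (simp add: diffs_def Suc_mult_abel_poly_self del: of_nat_Suc)
  moreover have "eventually (\<lambda>u. \<bar>u\<bar> < R) (nhds u)"
    using u by (intro eventually_nhds_in_open[of "{u. \<bar>u\<bar> < R}", simplified] open_Collect_less
        continuous_intros)
  then have "eventually (\<lambda>u. tree_fn u = (\<Sum>n. ?c n * u ^ n)) (nhds u)"
    by eventually_elim (rule tree_fn_powser)
  ultimately show ?thesis
    by (subst DERIV_cong_ev[OF refl _ refl]) auto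
qed

lemma has_derivative_abel_gf:
  assumes a: "0 \<le> \<alpha>" and u: "\<bar>u\<bar> < R"
  shows "(abel_gf \<alpha> has_real_derivative
           \<alpha> * (\<Sum>n. abel_power \<beta> n \<beta> * u ^ n) * abel_gf \<alpha> u) (at u)"
proof -
  let ?d = "diffs (\<lambda>n. abel_poly \<beta> n \<alpha>)"
  have der: "(abel_gf \<alpha> has_real_derivative (\<Sum>n. ?d n * u ^ n)) (at u)"
    unfolding abel_gf_def using u a summable_abel_poly
    by (intro termdiffs_strong'[where K = R]) auto
  have "summable (\<lambda>n. norm (abel_power \<beta> n \<beta> * u ^ n))"
    using summable_abel_power[OF beta(1), of "\<bar>u\<bar>"] u beta
    by (simp add: abs_mult power_abs abel_power_nonneg)
  moreover have "summable (\<lambda>n. norm (abel_poly \<beta> n \<alpha> * u ^ n))"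
    using summable_abel_poly[OF a, of "\<bar>u\<bar>"] u beta a
    by (simp add: abs_mult power_abs abel_poly_nonneg)
  ultimately have "(\<lambda>n. \<alpha> * (\<Sum>i\<le>n. (abel_power \<beta> i \<beta> * u ^ i) * (abel_poly \<beta> (n - i) \<alpha> * u ^ (n - i))))
      sums (\<alpha> * ((\<Sum>n. abel_power \<beta> n \<beta> * u ^ n) * abel_gf \<alpha> u))"
    unfolding abel_gf_def by (intro sums_mult Cauchy_product_sums)
  also have "(\<lambda>n. \<alpha> * (\<Sum>i\<le>n. (abel_power \<beta> i \<beta> * u ^ i) * (abel_poly \<beta> (n - i) \<alpha> * u ^ (n - i))))
      = (\<lambda>n. ?d n * u ^ n)"
  proof
    fix n
    have "(abel_power \<beta> i \<beta> * u ^ i) * (abel_poly \<beta> (n - i) \<alpha> * u ^ (n - i))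
        = abel_power \<beta> i \<beta> * abel_poly \<beta> (n - i) \<alpha> * u ^ n" if "i \<le> n" for i
      using that by (simp flip: power_add)
    then have "(\<Sum>i\<le>n. (abel_power \<beta> i \<beta> * u ^ i) * (abel_poly \<beta> (n - i) \<alpha> * u ^ (n - i)))
        = (\<Sum>i\<le>n. abel_power \<beta> i \<beta> * abel_poly \<beta> (n - i) \<alpha> * u ^ n)"
      by (intro sum.cong) auto
    then show "\<alpha> * (\<Sum>i\<le>n. (abel_power \<beta> i \<beta> * u ^ i) * (abel_poly \<beta> (n - i) \<alpha> * u ^ (n - i)))
        = ?d n * u ^ n"
      unfolding diffs_def abel_poly_recursion by (simp add: sum_distrib_right mult.assoc)
  qed
  finally show ?thesis
    using der by (simp add: sums_iff mult.assoc)
qed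

text \<open>
  Both sides satisfy the same linear differential equation in \<open>u\<close> and are \<open>1\<close> at \<open>u = 0\<close>.
\<close>
lemma abel_gf_eq_exp:
  assumes a: "0 \<le> \<alpha>" and u: "\<bar>u\<bar> < R"
  shows "abel_gf \<alpha> u = exp (\<alpha> * tree_fn u)"
proof -
  define h where "h = (\<lambda>u. abel_gf \<alpha> u * exp (- (\<alpha> * tree_fn u)))"
  have "\<exists>c. \<forall>u\<in>{-R<..<R}. h u = c"
  proof (rule has_field_derivative_zero_constant)
    fix u assume "u \<in> {-R<..<R}"
    then have u: "\<bar>u\<bar> < R" by auto
    have "(h has_real_derivative 0) (at u)"
      unfolding h_def
      by (rule derivative_eq_intros has_derivative_abel_gf[OF a u] has_derivative_tree_fn[OF u] refl)+
         (simp add: algebra_simps)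
    then show "(h has_real_derivative 0) (at u within {-R<..<R})"
      by (rule DERIV_subset) simp
  qed auto
  then have "h u = h 0"
    using u radius_pos by (auto simp: abs_less_iff)
  also have "h 0 = 1"
    by (simp add: h_def tree_fn_def abel_gf_def)
  finally show ?thesis
    by (simp add: h_def exp_minus field_simps)
qed

lemma tree_fn_functional_equation:
  assumes "\<bar>u\<bar> < R"
  shows "tree_fn u = u * exp (\<beta> * tree_fn u)" "inv_tree_fn \<beta> (tree_fn u) = u"
proof -
  show *: "tree_fn u = u * exp (\<beta> * tree_fn u)"
    using abel_gf_eq_exp[OF beta(1) assms] by (simp add: tree_fn_def)
  show "inv_tree_fn \<beta> (tree_fn u) = u"
    using * by (simp add: inv_tree_fn_def exp_minus field_simps)
qed

text \<open>
  For \<open>\<beta> > 0\<close> and \<open>0 < u < inv_tree_fn \<beta> s\<close> the equation \<open>inv_tree_fn \<beta> z = u\<close> has a second solution beyond \<open>1 / \<beta>\<close>. Continuity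
  selects the small one: to reach the other, \<open>tree_fn\<close>, which starts from \<open>0\<close>, would have to pass through the
  value \<open>s\<close>, but by the functional equation it can take this value only at \<open>u = inv_tree_fn \<beta> s\<close>.
\<close>
lemma tree_fn_less_cutoff:
  assumes u: "0 \<le> u" "u < R"
  shows "tree_fn u < s"
proof (rule ccontr)
  assume "\<not> tree_fn u < s"
  moreover have "isCont tree_fn v" if "v \<in> {0..u}" for v
    using has_derivative_tree_fn[of v] that u by (intro DERIV_isCont) auto
  ultimately obtain v where v: "0 \<le> v" "v \<le> u" "tree_fn v = s"
    using IVT'[of tree_fn 0 s u] u cutoff(1) continuous_at_imp_continuous_on[of "{0..u}" tree_fn]
    by (force simp: tree_fn_def)
  then show False
    using tree_fn_functional_equation(2)[of v] u by simp
qed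

lemma tree_fn_at_exp: "tree_fn u\<^sub>0 = 1"
proof -
  have u: "0 \<le> u\<^sub>0" "\<bar>u\<^sub>0\<bar> < R" using radius by auto
  have t: "0 \<le> tree_fn u\<^sub>0"
    using tree_fn_functional_equation(1)[OF u(2)] by (metis exp_gt_zero less_eq_real_def mult_pos_pos)
  have lt: "tree_fn u\<^sub>0 < s"
    using tree_fn_less_cutoff radius by simp
  have eq: "inv_tree_fn \<beta> (tree_fn u\<^sub>0) = inv_tree_fn \<beta> 1"
    using tree_fn_functional_equation(2)[OF u(2)] by (simp add: inv_tree_fn_def)
  have "\<beta> * tree_fn u\<^sub>0 < 1"
    using mult_left_mono[of "tree_fn u\<^sub>0" s \<beta>] lt beta cutoff by simp
  then show ?thesis
    using inv_tree_fn_strict_mono[of \<beta> "tree_fn u\<^sub>0" 1] inv_tree_fn_strict_mono[of \<beta> 1 "tree_fn u\<^sub>0"] eq t beta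
    by (cases "tree_fn u\<^sub>0" "1::real" rule: linorder_cases) auto
qed

text \<open>Differentiate \<open>inv_tree_fn \<beta> (tree_fn u) = u\<close> at the point where the tree function is \<open>1\<close>.\<close>
lemma tree_fn_derivative_at_exp: "u\<^sub>0 * (\<Sum>n. abel_power \<beta> n \<beta> * u\<^sub>0 ^ n) = 1 / (1 - \<beta>)"
proof -
  define D where "D = (\<Sum>n. abel_power \<beta> n \<beta> * u\<^sub>0 ^ n)"
  have u: "\<bar>u\<^sub>0\<bar> < R" using radius by auto
  have 1: "((\<lambda>u. inv_tree_fn \<beta> (tree_fn u)) has_real_derivative (1 - \<beta>) * u\<^sub>0 * D) (at u\<^sub>0)"
    unfolding inv_tree_fn_def D_def
    by (rule derivative_eq_intros has_derivative_tree_fn[OF u] refl)+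
       (simp add: tree_fn_at_exp algebra_simps)
  have "eventually (\<lambda>u. \<bar>u\<bar> < R) (nhds u\<^sub>0)"
    using u by (intro eventually_nhds_in_open[of "{u. \<bar>u\<bar> < R}", simplified] open_Collect_less
        continuous_intros)
  then have "eventually (\<lambda>u. inv_tree_fn \<beta> (tree_fn u) = u) (nhds u\<^sub>0)"
    by eventually_elim (rule tree_fn_functional_equation)
  then have "((\<lambda>u. inv_tree_fn \<beta> (tree_fn u)) has_real_derivative 1) (at u\<^sub>0)"
    by (subst DERIV_cong_ev[OF refl _ refl]) auto
  with 1 have "(1 - \<beta>) * u\<^sub>0 * D = 1"
    by (rule DERIV_unique)
  then show ?thesis
    using beta unfolding D_def by (simp add: field_simps)
qed

section \<open>Moments of the generalized Poisson law\<close>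

definition moment :: "nat \<Rightarrow> real \<Rightarrow> real" where
  "moment j \<alpha> = (\<Sum>k. gen_poisson \<beta> k \<alpha> * real k ^ j)"

text \<open>
  The law with parameter \<open>\<alpha>\<close> is that of a Poisson number of independent jumps in \<open>{1, 2, \<dots>}\<close>, those of size
  \<open>i + 1\<close> occurring with intensity \<open>\<alpha> * jump i / (i + 1)\<close>. Thus \<open>jump\<close> weighs the intensity by the size,
  and the index \<open>i\<close> is the size minus one, as in \<open>abel_poly_recursion\<close>.
\<close>
definition jump :: "nat \<Rightarrow> real" where
  "jump i = abel_power \<beta> i \<beta> * u\<^sub>0 ^ Suc i"

definition jump_moment :: "nat \<Rightarrow> real" where
  "jump_moment j = (\<Sum>i. jump i * real (Suc i) ^ j)"

lemma gen_poisson_nonneg: "0 \<le> \<alpha> \<Longrightarrow> 0 \<le> gen_poisson \<beta> k \<alpha>"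
  using beta by (simp add: gen_poisson_def)

lemma jump_nonneg: "0 \<le> jump i"
  using beta by (simp add: jump_def abel_power_nonneg)

lemma summable_moment:
  assumes "0 \<le> \<alpha>"
  shows "summable (\<lambda>k. gen_poisson \<beta> k \<alpha> * real k ^ j)"
proof -
  have "summable (\<lambda>k. real k ^ j * abel_poly \<beta> k \<alpha> * u\<^sub>0 ^ k * exp (- \<alpha>))"
    by (intro summable_mult2 summable_power_times_powser[where r = R] summable_abel_poly)
       (use assms radius in auto)
  then show ?thesis
    by (simp add: gen_poisson_abel_poly mult_ac)
qed

lemma summable_jump_moment: "summable (\<lambda>i. jump i * real (Suc i) ^ j)"
proof -
  have "summable (\<lambda>n. real n ^ Suc j * (case n of 0 \<Rightarrow> 0 | Suc m \<Rightarrow> abel_poly \<beta> m \<beta>) * u\<^sub>0 ^ n)"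
    by (intro summable_power_times_powser[where r = R] tree_fn_powser(2)) (use radius in auto)
  then have "summable (\<lambda>n. real (Suc n) ^ Suc j * abel_poly \<beta> n \<beta> * u\<^sub>0 ^ Suc n)"
    by (subst (asm) summable_Suc_iff [symmetric]) simp
  moreover have "real (Suc n) ^ Suc j * abel_poly \<beta> n \<beta> * u\<^sub>0 ^ Suc n = jump n * real (Suc n) ^ j" for n
    by (simp add: jump_def Suc_mult_abel_poly_self [symmetric] mult_ac del: of_nat_Suc)
  ultimately show ?thesis
    by (simp only:)
qed

lemma moment_nonneg: "0 \<le> \<alpha> \<Longrightarrow> 0 \<le> moment j \<alpha>"
  unfolding moment_def by (intro suminf_nonneg summable_moment) (auto simp: gen_poisson_nonneg)

lemma jump_moment_nonneg: "0 \<le> jump_moment j"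
  unfolding jump_moment_def by (intro suminf_nonneg summable_jump_moment) (auto simp: jump_nonneg)

lemma moment_0:
  assumes "0 \<le> \<alpha>"
  shows "moment 0 \<alpha> = 1"
proof -
  have "(\<lambda>k. abel_poly \<beta> k \<alpha> * u\<^sub>0 ^ k) sums exp \<alpha>"
    using summable_abel_poly[of \<alpha> u\<^sub>0] abel_gf_eq_exp[of \<alpha> u\<^sub>0] assms radius
    by (simp add: sums_iff abel_gf_def tree_fn_at_exp)
  then have "(\<lambda>k. abel_poly \<beta> k \<alpha> * u\<^sub>0 ^ k * exp (- \<alpha>)) sums (exp \<alpha> * exp (- \<alpha>))"
    by (rule sums_mult2)
  then show ?thesis
    by (simp add: moment_def gen_poisson_abel_poly sums_iff flip: exp_add)
qed

lemma jump_moment_0: "jump_moment 0 = 1 / (1 - \<beta>)"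
proof -
  have "summable (\<lambda>n. abel_power \<beta> n \<beta> * u\<^sub>0 ^ n)"
    using radius beta by (intro summable_abel_power) auto
  then have "jump_moment 0 = u\<^sub>0 * (\<Sum>n. abel_power \<beta> n \<beta> * u\<^sub>0 ^ n)"
    by (subst suminf_mult [symmetric]) (auto simp: jump_moment_def jump_def mult_ac)
  then show ?thesis
    by (simp add: tree_fn_derivative_at_exp)
qed

lemma gen_poisson_recursion:
  "real (Suc n) * gen_poisson \<beta> (Suc n) \<alpha> = \<alpha> * (\<Sum>i\<le>n. jump i * gen_poisson \<beta> (n - i) \<alpha>)"
proof -
  have "jump i * gen_poisson \<beta> (n - i) \<alpha>
      = abel_power \<beta> i \<beta> * abel_poly \<beta> (n - i) \<alpha> * (u\<^sub>0 ^ Suc n * exp (- \<alpha>))" if "i \<le> n" for i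
  proof -
    have "u\<^sub>0 ^ Suc n = u\<^sub>0 ^ Suc i * u\<^sub>0 ^ (n - i)"
      using that by (simp flip: power_add)
    then show ?thesis
      by (simp add: jump_def gen_poisson_abel_poly)
  qed
  then have "(\<Sum>i\<le>n. jump i * gen_poisson \<beta> (n - i) \<alpha>)
      = (\<Sum>i\<le>n. abel_power \<beta> i \<beta> * abel_poly \<beta> (n - i) \<alpha>) * (u\<^sub>0 ^ Suc n * exp (- \<alpha>))"
    by (simp add: sum_distrib_right)
  moreover have "real (Suc n) * gen_poisson \<beta> (Suc n) \<alpha>
      = real (Suc n) * abel_poly \<beta> (Suc n) \<alpha> * (u\<^sub>0 ^ Suc n * exp (- \<alpha>))"
    by (simp add: gen_poisson_abel_poly)
  ultimately show ?thesis
    by (simp only: abel_poly_recursion mult.assoc)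
qed

text \<open>
  The recursion \<open>k p\<^sub>k = \<alpha> \<Sum>\<^sub>i c\<^sub>i p\<^bsub>k - i - 1\<^esub>\<close> of the probabilities is multiplied by \<open>k ^ j\<close>, where
  \<open>k = (k - i - 1) + (i + 1)\<close> is expanded by the binomial theorem; each resulting term is a Cauchy product of two
  absolutely convergent series.
\<close>
lemma moment_recursion:
  assumes a: "0 \<le> \<alpha>"
  shows "moment (Suc j) \<alpha> = \<alpha> * (\<Sum>l\<le>j. real (j choose l) * jump_moment (j - l) * moment l \<alpha>)"
proof -
  define T where "T = (\<lambda>l n. \<Sum>i\<le>n. (jump i * real (Suc i) ^ (j - l)) *
      (gen_poisson \<beta> (n - i) \<alpha> * real (n - i) ^ l))"
  have "T l sums (jump_moment (j - l) * moment l \<alpha>)" for l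
    unfolding T_def jump_moment_def moment_def
    using summable_jump_moment summable_moment[OF a]
    by (intro Cauchy_product_sums) (simp_all add: abs_mult jump_nonneg gen_poisson_nonneg a
        del: of_nat_Suc)
  then have 1: "(\<lambda>n. \<alpha> * (\<Sum>l\<le>j. real (j choose l) * T l n)) sums
      (\<alpha> * (\<Sum>l\<le>j. real (j choose l) * (jump_moment (j - l) * moment l \<alpha>)))"
    by (intro sums_mult sums_sum)
  have 2: "\<alpha> * (\<Sum>l\<le>j. real (j choose l) * T l n) = gen_poisson \<beta> (Suc n) \<alpha> * real (Suc n) ^ Suc j" for n
  proof -
    have "(\<Sum>l\<le>j. real (j choose l) * T l n)
        = (\<Sum>i\<le>n. jump i * gen_poisson \<beta> (n - i) \<alpha> *
            (\<Sum>l\<le>j. real (j choose l) * real (n - i) ^ l * real (Suc i) ^ (j - l)))"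
      unfolding T_def sum_distrib_left by (subst sum.swap) (simp add: mult_ac)
    also have "\<dots> = (\<Sum>i\<le>n. jump i * gen_poisson \<beta> (n - i) \<alpha> * (real (n - i) + real (Suc i)) ^ j)"
      by (simp only: binomial_ring)
    also have "\<dots> = (\<Sum>i\<le>n. jump i * gen_poisson \<beta> (n - i) \<alpha>) * real (Suc n) ^ j"
      unfolding sum_distrib_right
    proof (rule sum.cong)
      fix i assume "i \<in> {..n}"
      then have "real (n - i) + real (Suc i) = real (Suc n)" by simp
      then show "jump i * gen_poisson \<beta> (n - i) \<alpha> * (real (n - i) + real (Suc i)) ^ j
          = jump i * gen_poisson \<beta> (n - i) \<alpha> * real (Suc n) ^ j"
        by (simp only:)
    qed simp
    finally show ?thesis
      using gen_poisson_recursion[of n \<alpha>] by (simp del: of_nat_Suc add: mult_ac)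
  qed
  have "(\<lambda>k. gen_poisson \<beta> k \<alpha> * real k ^ Suc j) sums
      (\<alpha> * (\<Sum>l\<le>j. real (j choose l) * (jump_moment (j - l) * moment l \<alpha>)))"
    using 1 unfolding 2
    using sums_Suc_iff[of "\<lambda>k. gen_poisson \<beta> k \<alpha> * real k ^ Suc j"] by simp
  then show ?thesis
    by (simp only: moment_def sums_iff mult.assoc)
qed

corollary moment_1: "0 \<le> \<alpha> \<Longrightarrow> moment 1 \<alpha> = \<alpha> / (1 - \<beta>)"
  using moment_recursion[of \<alpha> 0] by (simp add: jump_moment_0 moment_0)

text \<open>
  This serves twice: in the induction step of the bound on the moments, and for the central moment.
\<close>
lemma moment_sum_bound:
  assumes "\<And>l. l \<le> j \<Longrightarrow> \<exists>C. \<forall>\<alpha>\<ge>0. moment l \<alpha> \<le> C * (1 + \<alpha>) ^ l"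
    and w: "\<And>l. l \<le> j \<Longrightarrow> 0 \<le> w l"
  shows "\<exists>C. \<forall>\<alpha>\<ge>0. (\<Sum>l\<le>j. w l * moment l \<alpha>) \<le> C * (1 + \<alpha>) ^ j"
proof -
  obtain C where C: "\<And>l \<alpha>. l \<le> j \<Longrightarrow> 0 \<le> \<alpha> \<Longrightarrow> moment l \<alpha> \<le> C l * (1 + \<alpha>) ^ l"
    using assms(1) by metis
  have "(\<Sum>l\<le>j. w l * moment l \<alpha>) \<le> (\<Sum>l\<le>j. w l * \<bar>C l\<bar>) * (1 + \<alpha>) ^ j" if a: "0 \<le> \<alpha>" for \<alpha>
    unfolding sum_distrib_right
  proof (rule sum_mono)
    fix l assume "l \<in> {..j}"
    then have l: "l \<le> j" by simp
    have "moment l \<alpha> \<le> \<bar>C l\<bar> * (1 + \<alpha>) ^ l"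
      using a by (intro order.trans[OF C[OF l a]] mult_right_mono) auto
    also have "\<dots> \<le> \<bar>C l\<bar> * (1 + \<alpha>) ^ j"
      using a l by (intro mult_left_mono power_increasing) auto
    finally show "w l * moment l \<alpha> \<le> w l * \<bar>C l\<bar> * (1 + \<alpha>) ^ j"
      using mult_left_mono[OF _ w[OF l]] by (simp add: mult.assoc)
  qed
  then show ?thesis by blast
qed

lemma moment_bound: "\<exists>C. \<forall>\<alpha>\<ge>0. moment j \<alpha> \<le> C * (1 + \<alpha>) ^ j"
proof (induction j rule: less_induct)
  case (less j)
  show ?case
  proof (cases j)
    case 0
    then show ?thesis by (auto simp: moment_0 intro!: exI[of _ 1])
  next
    case (Suc i)
    have "\<exists>C. \<forall>\<alpha>\<ge>0. (\<Sum>l\<le>i. (real (i choose l) * jump_moment (i - l)) * moment l \<alpha>)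
        \<le> C * (1 + \<alpha>) ^ i"
      by (rule moment_sum_bound) (use less.IH Suc jump_moment_nonneg in auto)
    then obtain C where C: "\<And>\<alpha>. 0 \<le> \<alpha> \<Longrightarrow>
        (\<Sum>l\<le>i. (real (i choose l) * jump_moment (i - l)) * moment l \<alpha>) \<le> C * (1 + \<alpha>) ^ i"
      by blast
    have "moment j \<alpha> \<le> \<bar>C\<bar> * (1 + \<alpha>) ^ j" if a: "0 \<le> \<alpha>" for \<alpha>
    proof -
      have "moment j \<alpha> \<le> \<alpha> * (C * (1 + \<alpha>) ^ i)"
        unfolding Suc moment_recursion[OF a] using C[OF a] a by (rule mult_left_mono)
      also have "\<dots> \<le> \<alpha> * (\<bar>C\<bar> * (1 + \<alpha>) ^ i)"
        using a by (intro mult_left_mono mult_right_mono) auto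
      also have "\<dots> \<le> (1 + \<alpha>) * (\<bar>C\<bar> * (1 + \<alpha>) ^ i)"
        using a by (intro mult_right_mono) auto
      finally show ?thesis
        by (simp add: Suc mult_ac)
    qed
    then show ?thesis by blast
  qed
qed

lemma central_moment:
  assumes a: "0 \<le> \<alpha>"
  defines "\<mu> \<equiv> \<alpha> / (1 - \<beta>)"
  shows "(\<lambda>k. gen_poisson \<beta> k \<alpha> * ((real k - \<mu>)\<^sup>2 * real k ^ p)) sums
      (moment (Suc (Suc p)) \<alpha> - 2 * \<mu> * moment (Suc p) \<alpha> + \<mu>\<^sup>2 * moment p \<alpha>)"
proof -
  have "(\<lambda>k. gen_poisson \<beta> k \<alpha> * real k ^ j) sums moment j \<alpha>" for j
    using summable_moment[OF a] by (simp add: moment_def summable_sums)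
  then have "(\<lambda>k. gen_poisson \<beta> k \<alpha> * real k ^ Suc (Suc p)
        - 2 * \<mu> * (gen_poisson \<beta> k \<alpha> * real k ^ Suc p)
        + \<mu>\<^sup>2 * (gen_poisson \<beta> k \<alpha> * real k ^ p)) sums
      (moment (Suc (Suc p)) \<alpha> - 2 * \<mu> * moment (Suc p) \<alpha> + \<mu>\<^sup>2 * moment p \<alpha>)"
    by (intro sums_add sums_diff sums_mult)
  then show ?thesis
    by (simp add: power2_eq_square algebra_simps)
qed

text \<open>
  The moment recursion for \<open>Suc (Suc p)\<close> has last term \<open>\<mu> * moment (Suc p) \<alpha>\<close>. This cancels one of the two negative
  copies of that product; the other one and the term \<open>\<mu>\<^sup>2 * moment p \<alpha>\<close> combine to \<open>- \<mu> * (moment (Suc p) \<alpha> - \<mu> * moment p \<alpha>)\<close>. By the recursion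
  for \<open>Suc p\<close>, whose last term is \<open>\<mu> * moment p \<alpha>\<close>, the bracket is a sum of nonnegative terms.
\<close>
lemma central_moment_le:
  assumes a: "0 \<le> \<alpha>"
  defines "\<mu> \<equiv> \<alpha> / (1 - \<beta>)"
  shows "moment (Suc (Suc p)) \<alpha> - 2 * \<mu> * moment (Suc p) \<alpha> + \<mu>\<^sup>2 * moment p \<alpha>
     \<le> \<alpha> * (\<Sum>l\<le>p. real (Suc p choose l) * jump_moment (Suc p - l) * moment l \<alpha>)"
proof -
  have mu: "\<mu> = \<alpha> * jump_moment 0"
    by (simp add: \<mu>_def jump_moment_0)
  have 1: "moment (Suc (Suc p)) \<alpha>
      = \<alpha> * (\<Sum>l\<le>p. real (Suc p choose l) * jump_moment (Suc p - l) * moment l \<alpha>)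
        + \<mu> * moment (Suc p) \<alpha>"
    unfolding moment_recursion[OF a, of "Suc p"] mu by (simp add: algebra_simps del: binomial_Suc_Suc)
  have "moment (Suc p) \<alpha>
      = \<alpha> * (\<Sum>l<p. real (p choose l) * jump_moment (p - l) * moment l \<alpha>) + \<mu> * moment p \<alpha>"
    unfolding moment_recursion[OF a, of p] mu lessThan_Suc_atMost [symmetric] by (simp add: algebra_simps)
  moreover have "0 \<le> \<alpha> * (\<Sum>l<p. real (p choose l) * jump_moment (p - l) * moment l \<alpha>)"
    using a by (intro mult_nonneg_nonneg sum_nonneg) (auto simp: jump_moment_nonneg moment_nonneg)
  ultimately have "\<mu> * moment p \<alpha> \<le> moment (Suc p) \<alpha>"
    by simp
  then have "\<mu> * (\<mu> * moment p \<alpha>) \<le> \<mu> * moment (Suc p) \<alpha>"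
    using a jump_moment_nonneg[of 0] mu by (intro mult_left_mono) auto
  then show ?thesis
    unfolding 1 by (simp add: power2_eq_square)
qed

lemma central_moment_bound:
  "\<exists>C. \<forall>\<alpha>\<ge>0. (\<Sum>k. gen_poisson \<beta> k \<alpha> * ((real k - \<alpha> / (1 - \<beta>))\<^sup>2 * real k ^ p))
     \<le> C * \<alpha> * (1 + \<alpha>) ^ p"
proof -
  have "\<exists>C. \<forall>\<alpha>\<ge>0. (\<Sum>l\<le>p. (real (Suc p choose l) * jump_moment (Suc p - l)) * moment l \<alpha>)
      \<le> C * (1 + \<alpha>) ^ p"
    by (rule moment_sum_bound[OF moment_bound])
       (intro mult_nonneg_nonneg jump_moment_nonneg of_nat_0_le_iff)
  then obtain C where C: "\<And>\<alpha>. 0 \<le> \<alpha> \<Longrightarrow>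
      (\<Sum>l\<le>p. (real (Suc p choose l) * jump_moment (Suc p - l)) * moment l \<alpha>) \<le> C * (1 + \<alpha>) ^ p"
    by blast
  have "(\<Sum>k. gen_poisson \<beta> k \<alpha> * ((real k - \<alpha> / (1 - \<beta>))\<^sup>2 * real k ^ p))
      \<le> C * \<alpha> * (1 + \<alpha>) ^ p" if a: "0 \<le> \<alpha>" for \<alpha>
    unfolding sums_unique[OF central_moment[OF a], symmetric]
    using order.trans[OF central_moment_le[OF a] mult_left_mono[OF C[OF a] a]]
    by (simp add: mult_ac)
  then show ?thesis by blast
qed

text \<open>
  Split \<open>Y / b - x\<close> at the mean of \<open>Y / b\<close>. The random part has a factor \<open>\<alpha> / b\<^sup>2 \<le> x / b\<close>, the bias is
  \<open>x * (a / (b * (1 - \<beta>)) - 1)\<close>; the remaining powers of \<open>(1 + \<alpha>) / b \<le> 1 + x\<close> need \<open>a \<le> b\<close> and \<open>1 \<le> b\<close>.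
  The constant does not depend on \<open>a\<close> and \<open>b\<close>.
\<close>
lemma weighted_square_deviation:
  "\<exists>C\<ge>0. \<forall>a b x. 0 \<le> a \<and> a \<le> b \<and> 1 \<le> b \<and> 0 \<le> x \<longrightarrow>
     summable (\<lambda>k. gen_poisson \<beta> k (a * x) * ((real k / b - x)\<^sup>2 * (real k / b) ^ p)) \<and>
     (\<Sum>k. gen_poisson \<beta> k (a * x) * ((real k / b - x)\<^sup>2 * (real k / b) ^ p))
       \<le> C * (1 + x) ^ p * (x\<^sup>2 * (a / (b * (1 - \<beta>)) - 1)\<^sup>2 + x / (b * (1 - \<beta>) ^ 3))"
proof -
  obtain C1 where C1: "\<And>\<alpha>. 0 \<le> \<alpha> \<Longrightarrow>
      (\<Sum>k. gen_poisson \<beta> k \<alpha> * ((real k - \<alpha> / (1 - \<beta>))\<^sup>2 * real k ^ p)) \<le> C1 * \<alpha> * (1 + \<alpha>) ^ p"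
    using central_moment_bound by blast
  obtain C2 where C2: "\<And>\<alpha>. 0 \<le> \<alpha> \<Longrightarrow> moment p \<alpha> \<le> C2 * (1 + \<alpha>) ^ p"
    using moment_bound by blast
  define C where "C = 2 * (\<bar>C1\<bar> + \<bar>C2\<bar>)"
  show ?thesis
  proof (intro exI[of _ C] allI impI conjI)
    show "0 \<le> C" by (simp add: C_def)
  next
    fix a b x :: real
    assume "0 \<le> a \<and> a \<le> b \<and> 1 \<le> b \<and> 0 \<le> x"
    then have ab: "0 \<le> a" "a \<le> b" "1 \<le> b" and x: "0 \<le> x" by auto
    define \<alpha> where "\<alpha> = a * x"
    have a: "0 \<le> \<alpha>" using ab x by (simp add: \<alpha>_def)
    define \<mu> where "\<mu> = \<alpha> / (1 - \<beta>)"
    define V where "V = (\<Sum>k. gen_poisson \<beta> k \<alpha> * ((real k - \<mu>)\<^sup>2 * real k ^ p))"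
    let ?f = "\<lambda>k. gen_poisson \<beta> k \<alpha> * ((real k / b - x)\<^sup>2 * (real k / b) ^ p)"
    let ?g = "\<lambda>k. 2 / b ^ (p + 2) * (gen_poisson \<beta> k \<alpha> * ((real k - \<mu>)\<^sup>2 * real k ^ p))
        + 2 * (\<mu> / b - x)\<^sup>2 / b ^ p * (gen_poisson \<beta> k \<alpha> * real k ^ p)"
    have g: "?g sums (2 / b ^ (p + 2) * V + 2 * (\<mu> / b - x)\<^sup>2 / b ^ p * moment p \<alpha>)"
      unfolding V_def moment_def
      using central_moment[OF a, of p] summable_moment[OF a, of p]
      by (intro sums_add sums_mult summable_sums) (auto simp: sums_iff \<mu>_def)
    have le: "?f k \<le> ?g k" for k
    proof -
      have "(real k / b - x)\<^sup>2 = ((real k / b - \<mu> / b) + (\<mu> / b - x))\<^sup>2" by simp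
      also have "\<dots> \<le> 2 * (real k / b - \<mu> / b)\<^sup>2 + 2 * (\<mu> / b - x)\<^sup>2"
        using zero_le_power2[of "(real k / b - \<mu> / b) - (\<mu> / b - x)"]
        unfolding power2_eq_square by (simp only: algebra_simps)
      also have "(real k / b - \<mu> / b)\<^sup>2 = (real k - \<mu>)\<^sup>2 / b\<^sup>2"
        by (simp add: power_divide flip: diff_divide_distrib)
      finally have "?f k \<le> gen_poisson \<beta> k \<alpha> *
          ((2 * ((real k - \<mu>)\<^sup>2 / b\<^sup>2) + 2 * (\<mu> / b - x)\<^sup>2) * (real k / b) ^ p)"
        using ab gen_poisson_nonneg[OF a] by (intro mult_left_mono mult_right_mono) auto
      also have "\<dots> = ?g k"
        using ab by (simp add: power_divide power_add power2_eq_square power4_eq_xxxx field_simps)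
      finally show ?thesis .
    qed
    have nn: "0 \<le> ?f k" for k
      using ab gen_poisson_nonneg[OF a] by simp
    show sm: "summable (\<lambda>k. gen_poisson \<beta> k (a * x) * ((real k / b - x)\<^sup>2 * (real k / b) ^ p))"
      unfolding \<alpha>_def [symmetric]
      by (rule summable_comparison_test'[OF sums_summable[OF g], of 0]) (use le nn in auto)
    have ax: "\<alpha> \<le> b * x" "1 + \<alpha> \<le> b * (1 + x)"
      using ab x mult_right_mono[of a b x] by (auto simp: \<alpha>_def algebra_simps)
    have V: "V \<le> \<bar>C1\<bar> * (b * x) * (b * (1 + x)) ^ p"
    proof -
      have "V \<le> C1 * \<alpha> * (1 + \<alpha>) ^ p"
        using C1[OF a] by (simp add: V_def \<mu>_def)
      also have "\<dots> \<le> \<bar>C1\<bar> * (b * x) * (b * (1 + x)) ^ p"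
        using a ab x ax by (intro mult_mono power_mono) auto
      finally show ?thesis .
    qed
    have M: "moment p \<alpha> \<le> \<bar>C2\<bar> * (b * (1 + x)) ^ p"
      using C2[OF a] a ab x ax by (intro order.trans[OF C2[OF a]] mult_mono power_mono) auto
    have mu: "\<mu> / b - x = x * (a / (b * (1 - \<beta>)) - 1)"
      by (simp add: \<mu>_def \<alpha>_def algebra_simps)
    have xb: "x / b \<le> x / (b * (1 - \<beta>) ^ 3)"
      using x ab beta power_le_one[of "1 - \<beta>" 3]
      by (intro divide_left_mono) (auto intro: mult_left_le)
    have C_eq: "2 * y * ((\<bar>C1\<bar> + \<bar>C2\<bar>) * z) = C * y * z" for y z
      by (simp add: C_def)
    have "suminf ?f \<le> 2 / b ^ (p + 2) * V + 2 * (\<mu> / b - x)\<^sup>2 / b ^ p * moment p \<alpha>"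
      using suminf_le[OF le] sm sums_summable[OF g] sums_unique[OF g] by (simp add: \<alpha>_def)
    also have "\<dots> \<le> 2 / b ^ (p + 2) * (\<bar>C1\<bar> * (b * x) * (b * (1 + x)) ^ p)
        + 2 * (\<mu> / b - x)\<^sup>2 / b ^ p * (\<bar>C2\<bar> * (b * (1 + x)) ^ p)"
      using V M ab by (intro add_mono mult_left_mono) auto
    also have "\<dots> = 2 * (1 + x) ^ p * (\<bar>C1\<bar> * (x / b) + \<bar>C2\<bar> * (\<mu> / b - x)\<^sup>2)"
      unfolding power_mult_distrib[of b "1 + x"]
      using ab by (simp add: power_add power2_eq_square field_simps)
    also have "\<dots> \<le> 2 * (1 + x) ^ p * ((\<bar>C1\<bar> + \<bar>C2\<bar>) * ((\<mu> / b - x)\<^sup>2 + x / (b * (1 - \<beta>) ^ 3)))"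
    proof (rule mult_left_mono)
      have "\<bar>C1\<bar> * (x / b) \<le> \<bar>C1\<bar> * ((\<mu> / b - x)\<^sup>2 + x / (b * (1 - \<beta>) ^ 3))"
        using xb by (intro mult_left_mono) (auto intro: add_increasing)
      moreover have "\<bar>C2\<bar> * (\<mu> / b - x)\<^sup>2 \<le> \<bar>C2\<bar> * ((\<mu> / b - x)\<^sup>2 + x / (b * (1 - \<beta>) ^ 3))"
        using x ab beta by (intro mult_left_mono) auto
      ultimately show "\<bar>C1\<bar> * (x / b) + \<bar>C2\<bar> * (\<mu> / b - x)\<^sup>2
          \<le> (\<bar>C1\<bar> + \<bar>C2\<bar>) * ((\<mu> / b - x)\<^sup>2 + x / (b * (1 - \<beta>) ^ 3))"
        by (simp add: distrib_right)
    qed (use x in auto)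
    finally show "(\<Sum>k. gen_poisson \<beta> k (a * x) * ((real k / b - x)\<^sup>2 * (real k / b) ^ p))
       \<le> C * (1 + x) ^ p * (x\<^sup>2 * (a / (b * (1 - \<beta>)) - 1)\<^sup>2 + x / (b * (1 - \<beta>) ^ 3))"
      unfolding mu C_eq by (simp add: \<alpha>_def power_mult_distrib)
  qed
qed

end

section \<open>Weighted norms and Taylor expansion\<close>

lemma weight_pos: "0 \<le> x \<Longrightarrow> 0 < weight p x"
  by (simp add: weight_def add_pos_nonneg)

lemma weight_le_1: "0 \<le> x \<Longrightarrow> weight p x \<le> 1"
  by (simp add: weight_def divide_le_eq add_pos_nonneg)

lemma weight_antimono: "0 \<le> x \<Longrightarrow> x \<le> y \<Longrightarrow> weight p y \<le> weight p x"
  by (auto simp: weight_def intro!: divide_left_mono power_mono mult_pos_pos add_pos_nonneg)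

lemma inverse_weight_le: "0 \<le> x \<Longrightarrow> 1 / weight p x \<le> 1 + x ^ p"
  by (simp add: weight_def)

lemma weight_mult_power_le:
  assumes "0 \<le> x"
  shows "weight p x * (1 + x) ^ p \<le> 2 ^ p"
proof (cases "p = 0")
  case False
  have "(1 + x) ^ p \<le> (2 * max 1 x) ^ p"
    using assms by (intro power_mono) auto
  also have "\<dots> = 2 ^ p * max 1 x ^ p"
    by (simp add: power_mult_distrib)
  also have "max 1 x ^ p \<le> 1 + x ^ p"
    using assms by (cases "x \<le> 1") (auto simp: max_def)
  finally show ?thesis
    using False assms by (simp add: weight_def divide_le_eq add_pos_nonneg mult_left_mono)
qed (simp add: weight_def)

lemma weight_le_wnorm:
  assumes "f \<in> B_space p" "0 \<le> x"
  shows "weight p x * \<bar>f x\<bar> \<le> wnorm p f"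
proof -
  have "\<exists>C. \<forall>x\<ge>0. \<bar>f x * weight p x\<bar> \<le> C"
    using assms(1) by (auto simp: B_space_def bounded_iff)
  then have "bdd_above ((\<lambda>x. weight p x * \<bar>f x\<bar>) ` {0..})"
    using weight_pos[of _ p] by (fastforce simp: bdd_above_def abs_mult mult.commute)
  then show ?thesis
    unfolding wnorm_def using assms(2) by (intro cSUP_upper) auto
qed

lemma wnorm_nonneg:
  assumes "f \<in> B_space p"
  shows "0 \<le> wnorm p f"
  using weight_le_wnorm[OF assms, of 0] weight_pos[of 0 p]
  by (meson abs_ge_zero mult_nonneg_nonneg order.refl order.strict_implies_order order.trans)

lemma abs_le_wnorm:
  assumes "f \<in> B_space p" "0 \<le> x"
  shows "\<bar>f x\<bar> \<le> wnorm p f * (1 / weight p x)"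
  using weight_le_wnorm[OF assms] weight_pos[of x p] assms by (simp add: field_simps)

lemma has_derivative_deriv0:
  assumes "f differentiable_on {0..}" "0 \<le> x"
  shows "(f has_real_derivative deriv0 f x) (at x within {0..})"
  using assms vector_derivative_works[of f "at x within {0..}"]
  by (auto simp: differentiable_on_def deriv0_def has_real_derivative_iff_has_vector_derivative)

text \<open>
  Between \<open>x\<close> and \<open>t\<close> the second derivative is bounded by its norm times the larger of the two inverse
  weights at the endpoints, for which their sum is a symmetric substitute. Applying the mean value inequality
  twice costs a factor \<open>2\<close> against the sharp remainder, but it works uniformly with the one-sided derivatives at \<open>0\<close>.
\<close>
lemma taylor_remainder_bound:
  assumes f: "f \<in> C2_space p" and x: "0 \<le> x" and t: "0 \<le> t"
  shows "\<bar>f t - f x - deriv0 f x * (t - x)\<bar>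
     \<le> wnorm p (deriv0 (deriv0 f)) * (1 / weight p x + 1 / weight p t) * (t - x)\<^sup>2"
proof -
  define I where "I = {min x t..max x t}"
  define M where "M = wnorm p (deriv0 (deriv0 f)) * (1 / weight p x + 1 / weight p t)"
  have I: "convex I" "I \<subseteq> {0..}" "x \<in> I" "t \<in> I"
    using x t by (auto simp: I_def)
  have B: "deriv0 (deriv0 f) \<in> B_space p"
    using f by (simp add: C2_space_def C_space_def)
  have d1: "(f has_real_derivative deriv0 f y) (at y within I)"
    and d2: "(deriv0 f has_real_derivative deriv0 (deriv0 f) y) (at y within I)" if "y \<in> I" for y
    using f that I by (auto simp: C2_space_def intro!: DERIV_subset[OF has_derivative_deriv0])
  have M2: "norm (deriv0 (deriv0 f) y) \<le> M" if y: "y \<in> I" for y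
  proof -
    have pos: "0 < weight p x" "0 < weight p t" "0 < weight p y" and y0: "0 \<le> y"
      using x t y I weight_pos by auto
    have "weight p (max x t) \<le> weight p y"
      using y0 y by (intro weight_antimono) (auto simp: I_def)
    then have "1 / weight p y \<le> 1 / weight p (max x t)"
      using pos by (intro divide_left_mono) (auto simp: max_def)
    also have "\<dots> \<le> 1 / weight p x + 1 / weight p t"
      using pos by (auto simp: max_def)
    finally have "wnorm p (deriv0 (deriv0 f)) * (1 / weight p y) \<le> M"
      unfolding M_def by (intro mult_left_mono wnorm_nonneg B)
    then show ?thesis
      using abs_le_wnorm[OF B y0] by simp
  qed
  have M0: "0 \<le> M"
    using order.trans[OF norm_ge_zero M2[OF I(3)]] .
  have M1: "norm (deriv0 f y - deriv0 f x) \<le> M * \<bar>t - x\<bar>" if y: "y \<in> I" for y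
  proof -
    have "norm (deriv0 f y - deriv0 f x) \<le> M * norm (y - x)"
      by (rule field_differentiable_bound[OF I(1) d2 M2 y I(3)])
    also have "\<dots> \<le> M * \<bar>t - x\<bar>"
      using M0 y by (intro mult_left_mono) (auto simp: I_def)
    finally show ?thesis .
  qed
  have "norm ((f t - deriv0 f x * t) - (f x - deriv0 f x * x)) \<le> M * \<bar>t - x\<bar> * norm (t - x)"
    by (rule field_differentiable_bound[OF I(1) _ M1 I(4,3)])
       (rule derivative_eq_intros d1 refl | simp)+
  also have "M * \<bar>t - x\<bar> * norm (t - x) = M * (t - x)\<^sup>2"
    by (simp add: power2_eq_square mult.assoc)
  finally show ?thesis
    by (simp add: M_def algebra_simps)
qed

section \<open>The error of the operators\<close>

text \<open>The quotients \<open>a n / b n\<close> increase to their limit \<open>1\<close>.\<close>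
lemma admissible_le:
  assumes ad: "admissible a b" and n: "1 \<le> n"
  shows "a n \<le> b n"
proof (rule ccontr)
  assume "\<not> a n \<le> b n"
  moreover have b1: "b m \<ge> 1" if "1 \<le> m" for m
    using ad that by (simp add: admissible_def)
  ultimately have gt: "1 < a n / b n"
    using n by (simp add: field_simps order.strict_trans2[OF zero_less_one])
  define c where "c = (a n / b n - 1) / 2"
  have c: "0 < c" using gt by (simp add: c_def)
  have "(\<lambda>n. a n / b n - 1) \<in> o(\<lambda>n. 1 / b n)"
    using ad by (simp add: admissible_def)
  then have "eventually (\<lambda>m. norm (a m / b m - 1) \<le> c * norm (1 / b m)) sequentially"
    using c by (rule landau_o.smallD)
  then obtain N where N: "\<And>m. N \<le> m \<Longrightarrow> norm (a m / b m - 1) \<le> c * norm (1 / b m)"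
    by (auto simp: eventually_sequentially)
  define m where "m = max n N"
  have m: "1 \<le> m" "n \<le> m" "N \<le> m" using n by (auto simp: m_def)
  have "c * norm (1 / b m) \<le> c * 1"
    using c b1[OF m(1)] by (intro mult_left_mono) auto
  then have "a m / b m - 1 \<le> c"
    using N[OF m(3)] by simp
  moreover have "a n / b n \<le> a m / b m"
    using ad n m by (auto simp: admissible_def mono_on_def)
  ultimately show False
    using gt unfolding c_def by argo
qed

text \<open>
  Total mass one and the exact mean turn the affine part of the expansion into the first term. The remainder is
  split by \<open>1 / weight p t \<le> 1 + t ^ p\<close> into the cases \<open>0\<close> and \<open>p\<close> of \<open>weighted_square_deviation\<close>, and
  \<open>weight p x\<close> absorbs both \<open>1 / weight p x\<close> and \<open>(1 + x) ^ p\<close>.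
\<close>
lemma operator_error_bound:
  assumes beta: "0 \<le> \<beta>" "\<beta> < 1"
  shows "\<exists>M>0. \<forall>a b f x n. f \<in> C2_space p \<and> 0 \<le> x \<and> 0 \<le> a n \<and> a n \<le> b n \<and> 1 \<le> b n \<longrightarrow>
     weight p x * \<bar>J_op \<beta> a b n f x - f x\<bar>
       \<le> wnorm p (deriv0 f) * \<bar>a n / (b n * (1 - \<beta>)) - 1\<bar> * x
         + wnorm p (deriv0 (deriv0 f)) * M * xi \<beta> a b n x"
proof -
  define D where "D = (\<lambda>q r s x. \<Sum>k. gen_poisson \<beta> k (r * x) * ((real k / s - x)\<^sup>2 * (real k / s) ^ q))"
  have D: "\<exists>C\<ge>0. \<forall>r s x. 0 \<le> r \<and> r \<le> s \<and> 1 \<le> s \<and> 0 \<le> x \<longrightarrow>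
      summable (\<lambda>k. gen_poisson \<beta> k (r * x) * ((real k / s - x)\<^sup>2 * (real k / s) ^ q)) \<and>
      D q r s x \<le> C * (1 + x) ^ q * (x\<^sup>2 * (r / (s * (1 - \<beta>)) - 1)\<^sup>2 + x / (s * (1 - \<beta>) ^ 3))" for q
    unfolding D_def by (rule weighted_square_deviation[OF beta])
  obtain C0 where C0: "0 \<le> C0" "\<And>r s x. 0 \<le> r \<and> r \<le> s \<and> 1 \<le> s \<and> 0 \<le> x \<Longrightarrow>
      summable (\<lambda>k. gen_poisson \<beta> k (r * x) * ((real k / s - x)\<^sup>2 * (real k / s) ^ 0)) \<and>
      D 0 r s x \<le> C0 * (1 + x) ^ 0 * (x\<^sup>2 * (r / (s * (1 - \<beta>)) - 1)\<^sup>2 + x / (s * (1 - \<beta>) ^ 3))"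
    using D[of 0] by blast
  obtain Cp where Cp: "0 \<le> Cp" "\<And>r s x. 0 \<le> r \<and> r \<le> s \<and> 1 \<le> s \<and> 0 \<le> x \<Longrightarrow>
      summable (\<lambda>k. gen_poisson \<beta> k (r * x) * ((real k / s - x)\<^sup>2 * (real k / s) ^ p)) \<and>
      D p r s x \<le> Cp * (1 + x) ^ p * (x\<^sup>2 * (r / (s * (1 - \<beta>)) - 1)\<^sup>2 + x / (s * (1 - \<beta>) ^ 3))"
    using D[of p] by blast
  \<comment> \<open>The summand \<open>1\<close> only makes the constant positive.\<close>
  define M where "M = 2 * C0 + 2 ^ p * Cp + 1"
  have "weight p x * \<bar>J_op \<beta> a b n f x - f x\<bar>
       \<le> wnorm p (deriv0 f) * \<bar>a n / (b n * (1 - \<beta>)) - 1\<bar> * x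
         + wnorm p (deriv0 (deriv0 f)) * M * xi \<beta> a b n x"
    if f: "f \<in> C2_space p" and x: "0 \<le> x" and an: "0 \<le> a n" "a n \<le> b n" and bn: "1 \<le> b n"
    for a b :: "nat \<Rightarrow> real" and f x n
  proof -
    define \<alpha> where "\<alpha> = a n * x"
    define w where "w = (\<lambda>k. gen_poisson \<beta> k \<alpha>)"
    define t where "t = (\<lambda>k. real k / b n)"
    define \<rho> where "\<rho> = (\<lambda>k. f (t k) - f x - deriv0 f x * (t k - x))"
    define N where "N = wnorm p (deriv0 (deriv0 f))"
    have a: "0 \<le> \<alpha>" using an x by (simp add: \<alpha>_def)
    have w0: "0 \<le> w k" for k
      using gen_poisson_nonneg[OF beta a] by (simp add: w_def)
    have t0: "0 \<le> t k" for k using bn by (simp add: t_def)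
    have fB: "f \<in> B_space p" and f1B: "deriv0 f \<in> B_space p" and f2B: "deriv0 (deriv0 f) \<in> B_space p"
      using f by (auto simp: C2_space_def C_space_def)
    have N0: "0 \<le> N" unfolding N_def by (rule wnorm_nonneg[OF f2B])
    have xi0: "0 \<le> xi \<beta> a b n x"
      using x bn beta by (simp add: xi_def)
    have moments: "(\<lambda>k. w k * t k ^ j) sums (moment \<beta> j \<alpha> / b n ^ j)" for j
      using sums_divide[OF summable_sums[OF summable_moment[OF beta a, of j]], of "b n ^ j"]
      by (simp add: w_def t_def moment_def[OF beta] power_divide)
    have total: "w sums 1"
      using moments[of 0] moment_0[OF beta a] by simp
    have mean: "(\<lambda>k. w k * (t k - x)) sums (x * (a n / (b n * (1 - \<beta>)) - 1))"
    proof -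
      have "(\<lambda>k. w k * t k ^ 1 - w k * x) sums (moment \<beta> 1 \<alpha> / b n ^ 1 - 1 * x)"
        by (intro sums_diff moments sums_mult2 total)
      then show ?thesis
        unfolding moment_1[OF beta a] by (simp add: \<alpha>_def algebra_simps)
    qed
    have sf: "summable (\<lambda>k. w k * f (t k))"
    proof (rule summable_comparison_test')
      show "summable (\<lambda>k. wnorm p f * (w k + w k * t k ^ p))"
        using sums_add[OF total moments[of p]] by (intro summable_mult) (simp add: sums_iff)
      fix k
      have "\<bar>f (t k)\<bar> \<le> wnorm p f * (1 + t k ^ p)"
        using abs_le_wnorm[OF fB t0]
          mult_left_mono[OF inverse_weight_le[OF t0] wnorm_nonneg[OF fB]] by (rule order.trans)
      then show "norm (w k * f (t k)) \<le> wnorm p f * (w k + w k * t k ^ p)"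
        using mult_left_mono[OF _ w0, of "\<bar>f (t k)\<bar>" _ k] w0[of k]
        by (fastforce simp: abs_mult algebra_simps)
    qed
    have "(\<lambda>k. w k * f (t k) - f x * w k - deriv0 f x * (w k * (t k - x))) sums
        (J_op \<beta> a b n f x - f x * 1 - deriv0 f x * (x * (a n / (b n * (1 - \<beta>)) - 1)))"
      using summable_sums[OF sf]
      by (intro sums_diff sums_mult total mean) (simp add: J_op_def w_def t_def \<alpha>_def)
    then have \<rho>: "(\<lambda>k. w k * \<rho> k) sums
        (J_op \<beta> a b n f x - f x - deriv0 f x * (x * (a n / (b n * (1 - \<beta>)) - 1)))"
      by (simp add: \<rho>_def algebra_simps)
    define S where "S = (\<lambda>q. D q (a n) (b n) x)"
    have S: "(\<lambda>k. w k * ((t k - x)\<^sup>2 * t k ^ 0)) sums S 0" "(\<lambda>k. w k * ((t k - x)\<^sup>2 * t k ^ p)) sums S p"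
      using C0(2)[of "a n" "b n" x] Cp(2)[of "a n" "b n" x] an bn x
      by (simp_all add: S_def D_def w_def t_def \<alpha>_def summable_sums)
    have S_le: "S 0 \<le> C0 * xi \<beta> a b n x" "S p \<le> Cp * (1 + x) ^ p * xi \<beta> a b n x"
      using C0(2)[of "a n" "b n" x] Cp(2)[of "a n" "b n" x] an bn x
      by (simp_all add: S_def xi_def)
    let ?g = "\<lambda>k. N * ((1 / weight p x + 1) * (w k * ((t k - x)\<^sup>2 * t k ^ 0))
        + w k * ((t k - x)\<^sup>2 * t k ^ p))"
    have g: "?g sums (N * ((1 / weight p x + 1) * S 0 + S p))"
      by (intro sums_mult sums_add S)
    have le: "norm (w k * \<rho> k) \<le> ?g k" for k
    proof -
      have "\<bar>\<rho> k\<bar> \<le> N * (1 / weight p x + 1 / weight p (t k)) * (t k - x)\<^sup>2"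
        unfolding \<rho>_def N_def by (rule taylor_remainder_bound[OF f x t0])
      also have "\<dots> \<le> N * (1 / weight p x + (1 + t k ^ p)) * (t k - x)\<^sup>2"
        by (intro mult_right_mono mult_left_mono add_left_mono inverse_weight_le t0 N0) simp
      finally have "w k * \<bar>\<rho> k\<bar> \<le> w k * (N * (1 / weight p x + (1 + t k ^ p)) * (t k - x)\<^sup>2)"
        by (rule mult_left_mono[OF _ w0])
      then show ?thesis
        using w0[of k] by (simp add: abs_mult algebra_simps)
    qed
    have triangle: "\<bar>u\<bar> \<le> \<bar>v\<bar> + c" if "\<bar>u - v\<bar> \<le> c" for u v c :: real
      using that by linarith
    have "\<bar>J_op \<beta> a b n f x - f x - deriv0 f x * (x * (a n / (b n * (1 - \<beta>)) - 1))\<bar>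
        \<le> N * ((1 / weight p x + 1) * S 0 + S p)"
      using norm_suminf_le[OF le sums_summable[OF g]] sums_unique[OF \<rho>] sums_unique[OF g] by simp
    then have "\<bar>J_op \<beta> a b n f x - f x\<bar> \<le> \<bar>deriv0 f x * (x * (a n / (b n * (1 - \<beta>)) - 1))\<bar>
        + N * ((1 / weight p x + 1) * S 0 + S p)"
      by (rule triangle)
    also have "\<bar>deriv0 f x * (x * (a n / (b n * (1 - \<beta>)) - 1))\<bar>
        = \<bar>deriv0 f x\<bar> * \<bar>a n / (b n * (1 - \<beta>)) - 1\<bar> * x"
      using x by (simp add: abs_mult)
    finally have "\<bar>J_op \<beta> a b n f x - f x\<bar>
        \<le> \<bar>deriv0 f x\<bar> * \<bar>a n / (b n * (1 - \<beta>)) - 1\<bar> * x + N * ((1 / weight p x + 1) * S 0 + S p)"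
      .
    then have "weight p x * \<bar>J_op \<beta> a b n f x - f x\<bar>
        \<le> weight p x * (\<bar>deriv0 f x\<bar> * \<bar>a n / (b n * (1 - \<beta>)) - 1\<bar> * x
            + N * ((1 / weight p x + 1) * S 0 + S p))"
      using weight_pos[OF x, of p] by (intro mult_left_mono) auto
    also have "\<dots> = (weight p x * \<bar>deriv0 f x\<bar>) * \<bar>a n / (b n * (1 - \<beta>)) - 1\<bar> * x
        + N * ((1 + weight p x) * S 0 + weight p x * S p)"
      using weight_pos[OF x, of p] by (simp add: field_simps)
    also have "\<dots> \<le> wnorm p (deriv0 f) * \<bar>a n / (b n * (1 - \<beta>)) - 1\<bar> * x + N * (M * xi \<beta> a b n x)"
    proof (intro add_mono mult_right_mono mult_left_mono weight_le_wnorm f1B x N0)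
      have "(1 + weight p x) * S 0 \<le> 2 * (C0 * xi \<beta> a b n x)"
      proof (rule mult_mono)
        show "0 \<le> S 0"
          using sums_le[OF _ sums_zero S(1)] w0 by simp
      qed (use S_le weight_le_1[OF x] in auto)
      moreover have "weight p x * S p \<le> 2 ^ p * (Cp * xi \<beta> a b n x)"
      proof -
        have "weight p x * S p \<le> weight p x * (Cp * (1 + x) ^ p * xi \<beta> a b n x)"
          using S_le weight_pos[OF x, of p] by (intro mult_left_mono) auto
        also have "\<dots> = (weight p x * (1 + x) ^ p) * (Cp * xi \<beta> a b n x)"
          by (simp add: mult_ac)
        also have "\<dots> \<le> 2 ^ p * (Cp * xi \<beta> a b n x)"
          using weight_mult_power_le[OF x] Cp(1) xi0 by (intro mult_right_mono) auto
        finally show ?thesis .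
      qed
      ultimately show "(1 + weight p x) * S 0 + weight p x * S p \<le> M * xi \<beta> a b n x"
        using xi0 by (simp add: M_def algebra_simps)
    qed auto
    finally show ?thesis
      by (simp add: N_def mult.assoc)
  qed
  moreover have "M > 0"
    using C0(1) Cp(1) by (simp add: M_def add_nonneg_pos)
  ultimately show ?thesis
    by blast
qed

theorem theorem2:
  fixes \<beta> b1 :: real and p :: nat
  assumes "0 \<le> \<beta>" and "\<beta> < 1"
  shows "\<exists>M3::real. M3 > 0 \<and>
    (\<forall>a b. admissible a b \<and> b 1 = b1 \<longrightarrow>
      (\<forall>f \<in> C2_space p. \<forall>x\<ge>0. \<forall>n\<ge>1.
         weight p x * \<bar>J_op \<beta> a b n f x - f x\<bar>
           \<le> wnorm p (deriv0 f) * \<bar>a n / (b n * (1 - \<beta>)) - 1\<bar> * x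
             + wnorm p (deriv0 (deriv0 f)) * M3 * xi \<beta> a b n x))"
proof -
  obtain M where M: "M > 0" "\<And>a b f x n. f \<in> C2_space p \<and> 0 \<le> x \<and> 0 \<le> a n \<and> a n \<le> b n \<and> 1 \<le> b n \<Longrightarrow>
     weight p x * \<bar>J_op \<beta> a b n f x - f x\<bar>
       \<le> wnorm p (deriv0 f) * \<bar>a n / (b n * (1 - \<beta>)) - 1\<bar> * x
         + wnorm p (deriv0 (deriv0 f)) * M * xi \<beta> a b n x"
    using operator_error_bound[OF assms, of p] by blast
  show ?thesis
  proof (intro exI[of _ M] conjI allI impI ballI)
    fix a b f and x :: real and n :: nat
    assume ad: "admissible a b \<and> b 1 = b1" and f: "f \<in> C2_space p" and x: "0 \<le> x" and n: "1 \<le> n"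
    have "1 \<le> a n" "1 \<le> b n"
      using ad n by (auto simp: admissible_def)
    moreover have "a n \<le> b n"
      using ad n by (intro admissible_le) auto
    ultimately show "weight p x * \<bar>J_op \<beta> a b n f x - f x\<bar>
        \<le> wnorm p (deriv0 f) * \<bar>a n / (b n * (1 - \<beta>)) - 1\<bar> * x
          + wnorm p (deriv0 (deriv0 f)) * M * xi \<beta> a b n x"
      using f x by (intro M(2)) auto
  qed (rule M(1))
qed

end
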